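(* Let $L$ be a countable bounded distributive lattice, and let $X$ be its Priestley space (which is then metrizable). (1) $X$ is not a p-space if and only if one of $Z_1,Z_2,Z_3$ is a p-configuration for $X$; that is, if and only if there exist $i\in\{1,2,3\}$, a map $e\colon Z_i\to X$ that is both a topological embedding and an order embedding, and an open upset $U$ of $X$ with $e(y)\in U$ such that $e^{-1}({\downarrow}U)=\{x,y\}$. (2) $L$ is not a p-algebra if and only if there is $i\in\{1,2,3\}$ such that $L_i$ is a homomorphic image of $L$ via an onto bounded lattice homomorphism $h_i\colon L\to L_i$ with the following property: there is $a\in L$ such that $h_i[I_{a\to 0}]=I_{c_i\to 0}$, where $c_1=c$, $c_2=\{0\}$, and $c_3=(\varnothing,1)$.
   Context: For a poset $X$ and $A\subseteq X$, ${\downarrow}A=\{x\mid x\le a\text{ for some }a\in A\}$ and ${\uparrow}A=\{x\mid a\le x\text{ for some }a\in A\}$; $A$ is an upset if ${\uparrow}A=A$. A Priestley space is a compact topological space $X$ with a partial order such that whenever $x\nleq y$ there is a clopen upset $U$ with $x\in U$, $y\notin U$. The Priestley space of a bounded distributive lattice $L$ is the set of prime filters of $L$ ordered by inclusion, with topology generated by the basis $\{\alpha(a)\setminus\alpha(b)\mid a,b\in L\}$, where $\alpha(a)$ is the set of prime filters containing $a$. "Countable" includes finite. A p-algebra is a pseudocomplemented distributive lattice: a bounded distributive lattice in which for each $a$ there is a largest element $d$ with $d\wedge a=0$. A p-space is a Priestley space in which the downset of each open upset is open. For $a,b$ in a bounded distributive lattice $L$, $I_{a\to b}:=\{d\in L\mid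 d\wedge a\le b\}$. In $I_{c_i\to 0}$, this is computed in $L_i$, with $0$ the bottom of $L_i$. The Priestley spaces $Z_1,Z_2,Z_3$ have the same underlying topological space: the one-point compactification of the countable discrete space $\{y\}\cup\{z_n\mid n\in\omega\}$ (all points distinct), where $x$ is the added point. Their orders have exactly the following strict relations. - $Z_1$: $x<y$; $z_0>z_1>z_2>\cdots$; $x<z_n$ for all $n$. - $Z_2$: $x<y$ and $x<z_n$ for all $n$. - $Z_3$: $x<y$ only. The lattices $L_i$ and elements $c_i$ are as follows. - $L_1$ is the lattice of clopen upsets of $Z_1$, i.e. $\varnothing$, $\{y\}$, ${\uparrow}z_n=\{z_0,\dots,z_n\}$, ${\uparrow}z_n\cup\{y\}$ ($n\in\omega$), and $Z_1$, under inclusion; $c=\{y\}$. - $L_2$ is the lattice $\mathcal{P}_{\rm fin}(\omega)$ of finite subsets of $\omega$ under inclusion together with an added top element; $c_2=\{0\}$ is the singleton of the number $0\in\omega$. - $L_3$ is the bounded sublattice of ${\bf CF}(\omega)\times{\bf 2}$ consisting of the pairs $(A,n)$ with $A$ finite or $n=1$, where ${\bf CF}(\omega)$ is the Boolean algebra of finite and cofinite subsets of $\omega$ and ${\bf 2}=\{0,1\}$; $c_3=(\varnothing,1)$. *)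

theory Defs
  imports
    "HOL-Analysis.Analysis"
    "HOL-Library.Lattice_Constructions"
    "HOL-Library.Product_Order"
begin

section \<open>Priestley spaces and p-spaces\<close>

text \<open>
  An ordered space is a topology \<open>T\<close> together with an order relation \<open>r\<close> on its
  carrier; \<open>(x, y) \<in> r\<close> means that \<open>x\<close> is below \<open>y\<close>.
\<close>

definition downset :: "'p rel \<Rightarrow> 'p set \<Rightarrow> 'p set" where
  "downset r A = {x. \<exists>a\<in>A. (x, a) \<in> r}"

definition upset :: "'p rel \<Rightarrow> 'p set \<Rightarrow> 'p set" where
  "upset r A = {x. \<exists>a\<in>A. (a, x) \<in> r}"

definition is_upset :: "'p rel \<Rightarrow> 'p set \<Rightarrow> bool" where
  "is_upset r A \<longleftrightarrow> upset r A = A"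

definition clopenin :: "'p topology \<Rightarrow> 'p set \<Rightarrow> bool" where
  "clopenin T U \<longleftrightarrow> openin T U \<and> closedin T U"

definition priestley_space :: "'p topology \<Rightarrow> 'p rel \<Rightarrow> bool" where
  "priestley_space T r \<longleftrightarrow>
     compact_space T \<and> partial_order_on (topspace T) r \<and>
     (\<forall>x\<in>topspace T. \<forall>y\<in>topspace T. (x, y) \<notin> r \<longrightarrow>
        (\<exists>U. clopenin T U \<and> is_upset r U \<and> x \<in> U \<and> y \<notin> U))"

definition p_space :: "'p topology \<Rightarrow> 'p rel \<Rightarrow> bool" where
  "p_space T r \<longleftrightarrow>
     priestley_space T r \<and>
     (\<forall>U. openin T U \<and> is_upset r U \<longrightarrow> openin T (downset r U))"


section \<open>The Priestley space of a bounded distributive lattice\<close>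

definition prime_filter :: "'a::{distrib_lattice,bounded_lattice} set \<Rightarrow> bool" where
  "prime_filter F \<longleftrightarrow>
     F \<noteq> {} \<and> F \<noteq> UNIV \<and>
     (\<forall>a b. a \<in> F \<and> a \<le> b \<longrightarrow> b \<in> F) \<and>
     (\<forall>a b. a \<in> F \<and> b \<in> F \<longrightarrow> inf a b \<in> F) \<and>
     (\<forall>a b. sup a b \<in> F \<longrightarrow> a \<in> F \<or> b \<in> F)"

definition stone_map :: "'a::{distrib_lattice,bounded_lattice} \<Rightarrow> 'a set set" where
  "stone_map a = {F. prime_filter F \<and> a \<in> F}"

definition priestley_topology :: "'a::{distrib_lattice,bounded_lattice} set topology" where
  "priestley_topology = topology_generated_by {stone_map a - stone_map b | a b. True}"

definition priestley_order :: "'a::{distrib_lattice,bounded_lattice} set rel" where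
  "priestley_order = relation_of (\<subseteq>) {F. prime_filter F}"

lemma topspace_priestley_topology [simp]:
  "topspace priestley_topology = {F. prime_filter F}"
proof -
  have "prime_filter F \<Longrightarrow> F \<in> stone_map top - stone_map bot" for F :: "'a set"
    unfolding prime_filter_def stone_map_def by (auto intro: top_greatest bot_least)
  then show ?thesis
    unfolding priestley_topology_def topology_generated_by_topspace
    by (auto simp: stone_map_def)
qed


section \<open>p-algebras, relative annihilators, homomorphisms\<close>

definition p_algebra :: "'a::{distrib_lattice,bounded_lattice} itself \<Rightarrow> bool" where
  "p_algebra _ \<longleftrightarrow>
     (\<forall>a::'a. \<exists>d. inf d a = bot \<and> (\<forall>e. inf e a = bot \<longrightarrow> e \<le> d))"

text \<open>
  Below, a bounded lattice is either a whole type (carrier \<open>UNIV\<close>) or a bounded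
  sublattice \<open>M\<close> of one, with the inherited order, operations and bounds.
\<close>

definition bounded_sublattice :: "'b::bounded_lattice set \<Rightarrow> bool" where
  "bounded_sublattice M \<longleftrightarrow>
     bot \<in> M \<and> top \<in> M \<and> (\<forall>a\<in>M. \<forall>b\<in>M. inf a b \<in> M \<and> sup a b \<in> M)"

definition rel_annihilator :: "'b::bounded_lattice set \<Rightarrow> 'b \<Rightarrow> 'b \<Rightarrow> 'b set" where
  "rel_annihilator M a b = {d\<in>M. inf d a \<le> b}"

definition onto_bounded_lattice_hom ::
    "('a::bounded_lattice \<Rightarrow> 'b::bounded_lattice) \<Rightarrow> 'b set \<Rightarrow> bool" where
  "onto_bounded_lattice_hom h M \<longleftrightarrow>
     h bot = bot \<and> h top = top \<and>
     (\<forall>a b. h (inf a b) = inf (h a) (h b)) \<and>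
     (\<forall>a b. h (sup a b) = sup (h a) (h b)) \<and>
     range h = M"


section \<open>The Priestley spaces \<open>Z\<^sub>1\<close>, \<open>Z\<^sub>2\<close>, \<open>Z\<^sub>3\<close>\<close>

datatype isolated_point = Iso_y | Iso_z nat

type_synonym zpoint = "isolated_point option"

abbreviation x_pt :: zpoint where "x_pt \<equiv> None"
abbreviation y_pt :: zpoint where "y_pt \<equiv> Some Iso_y"
abbreviation z_pt :: "nat \<Rightarrow> zpoint" where "z_pt n \<equiv> Some (Iso_z n)"

definition Z_topology :: "zpoint topology" where
  "Z_topology = Alexandroff_compactification (discrete_topology UNIV)"

definition Z1_order :: "zpoint rel" where
  "Z1_order = Id \<union> {(x_pt, y_pt)} \<union> {(z_pt m, z_pt n) | m n. n < m} \<union> {(x_pt, z_pt n) | n. True}"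

definition Z2_order :: "zpoint rel" where
  "Z2_order = Id \<union> {(x_pt, y_pt)} \<union> {(x_pt, z_pt n) | n. True}"

definition Z3_order :: "zpoint rel" where
  "Z3_order = Id \<union> {(x_pt, y_pt)}"

definition p_configuration :: "zpoint rel \<Rightarrow> 'p topology \<Rightarrow> 'p rel \<Rightarrow> bool" where
  "p_configuration s T r \<longleftrightarrow>
     (\<exists>e U. embedding_map Z_topology T e \<and>
            (\<forall>u v. (u, v) \<in> s \<longleftrightarrow> (e u, e v) \<in> r) \<and>
            openin T U \<and> is_upset r U \<and> e y_pt \<in> U \<and>
            e -` downset r U = {x_pt, y_pt})"

lemma topspace_Z_topology [simp]: "topspace Z_topology = UNIV"
  by (auto simp: Z_topology_def notin_range_Some)

lemma openin_Z_topology_iff: "openin Z_topology V \<longleftrightarrow> (x_pt \<in> V \<longrightarrow> finite (- V))"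
proof
  assume "openin Z_topology V"
  then consider C where "V = Some ` C" | C where "finite C" "V = insert None (Some ` (- C))"
    unfolding Z_topology_def openin_Alexandroff_compactification
    by (auto simp: Compl_eq_Diff_UNIV compactin_discrete_topology)
  then show "x_pt \<in> V \<longrightarrow> finite (- V)"
  proof cases
    case 2
    have "- V \<subseteq> Some ` C"
    proof
      fix p assume "p \<in> - V"
      with 2 show "p \<in> Some ` C" by (cases p) auto
    qed
    with 2 show ?thesis by (meson finite_imageI finite_subset)
  qed auto
next
  assume fin: "x_pt \<in> V \<longrightarrow> finite (- V)"
  show "openin Z_topology V"
  proof (cases "x_pt \<in> V")
    case True
    define C where "C = Some -` (- V)"
    have "p \<in> V \<longleftrightarrow> p \<in> insert None (Some ` (UNIV - C))" for p
      using True by (cases p) (auto simp: C_def)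
    then have "V = insert None (Some ` (UNIV - C))" by blast
    moreover have "finite C"
      unfolding C_def using fin True by (intro finite_vimageI) auto
    ultimately show ?thesis
      unfolding Z_topology_def openin_Alexandroff_compactification
      by (auto simp: compactin_discrete_topology)
  next
    case False
    have "p \<in> V \<longleftrightarrow> p \<in> Some ` (Some -` V)" for p
      using False by (cases p) auto
    then have "V = Some ` (Some -` V)" by blast
    moreover have "openin (discrete_topology UNIV) (Some -` V)" by simp
    ultimately show ?thesis
      unfolding Z_topology_def openin_Alexandroff_compactification by blast
  qed
qed

lemma clopenin_Z_topology_iff:
  "clopenin Z_topology U \<longleftrightarrow> (if x_pt \<in> U then finite (- U) else finite U)"
  by (auto simp: clopenin_def closedin_def openin_Z_topology_iff Compl_eq_Diff_UNIV [symmetric])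

lemma compact_space_Z_topology: "compact_space Z_topology"
  by (simp add: Z_topology_def)

lemma priestley_space_Z1: "priestley_space Z_topology Z1_order"
  unfolding priestley_space_def
proof (intro conjI ballI impI)
  show "partial_order_on (topspace Z_topology) Z1_order"
    by (auto simp: partial_order_on_def preorder_on_def refl_on_def trans_def antisym_def Z1_order_def)
next
  fix p q assume pq: "(p, q) \<notin> Z1_order"
  show "\<exists>U. clopenin Z_topology U \<and> is_upset Z1_order U \<and> p \<in> U \<and> q \<notin> U"
  proof (cases p)
    case None
    then show ?thesis
      using pq by (cases q; simp add: Z1_order_def) (metis isolated_point.exhaust)
  next
    case (Some p')
    show ?thesis
    proof (cases p')
      case Iso_y
      then show ?thesis using Some pq
        by (intro exI[of _ "{y_pt}"])
           (auto simp: clopenin_Z_topology_iff is_upset_def upset_def Z1_order_def)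
    next
      case (Iso_z n)
      then show ?thesis using Some pq
        by (intro exI[of _ "z_pt ` {..n}"])
           (auto simp: clopenin_Z_topology_iff is_upset_def upset_def Z1_order_def)
    qed
  qed
qed (rule compact_space_Z_topology)

lemma priestley_space_Z2: "priestley_space Z_topology Z2_order"
  unfolding priestley_space_def
proof (intro conjI ballI impI)
  show "partial_order_on (topspace Z_topology) Z2_order"
    by (auto simp: partial_order_on_def preorder_on_def refl_on_def trans_def antisym_def Z2_order_def)
next
  fix p q assume pq: "(p, q) \<notin> Z2_order"
  show "\<exists>U. clopenin Z_topology U \<and> is_upset Z2_order U \<and> p \<in> U \<and> q \<notin> U"
  proof (cases p)
    case None
    then show ?thesis
      using pq by (cases q; simp add: Z2_order_def) (metis isolated_point.exhaust)
  next
    case (Some p')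
    then show ?thesis using pq
      by (intro exI[of _ "{p}"])
         (auto simp: clopenin_Z_topology_iff is_upset_def upset_def Z2_order_def)
  qed
qed (rule compact_space_Z_topology)

lemma priestley_space_Z3: "priestley_space Z_topology Z3_order"
  unfolding priestley_space_def
proof (intro conjI ballI impI)
  show "partial_order_on (topspace Z_topology) Z3_order"
    by (auto simp: partial_order_on_def preorder_on_def refl_on_def trans_def antisym_def Z3_order_def)
next
  fix p q assume pq: "(p, q) \<notin> Z3_order"
  show "\<exists>U. clopenin Z_topology U \<and> is_upset Z3_order U \<and> p \<in> U \<and> q \<notin> U"
  proof (cases p)
    case None
    then show ?thesis using pq
      by (intro exI[of _ "- {q}"])
         (auto simp: clopenin_Z_topology_iff is_upset_def upset_def Z3_order_def)
  next
    case (Some p')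
    then show ?thesis using pq
      by (intro exI[of _ "{p}"])
         (auto simp: clopenin_Z_topology_iff is_upset_def upset_def Z3_order_def)
  qed
qed (rule compact_space_Z_topology)


section \<open>The lattices \<open>L\<^sub>1\<close>, \<open>L\<^sub>2\<close>, \<open>L\<^sub>3\<close>\<close>

definition L1 :: "zpoint set set" where
  "L1 = {U. clopenin Z_topology U \<and> is_upset Z1_order U}"

definition c1 :: "zpoint set" where
  "c1 = {y_pt}"

text \<open>
  The type \<open>'b top\<close> of \<^theory>\<open>HOL-Library.Lattice_Constructions\<close> is \<open>'b\<close> with a new
  greatest element \<open>Top\<close> adjoined; the library does not record that it is
  bounded when \<open>'b\<close> has a least element.
\<close>

instance top :: (order_bot) order_bot
proof
  fix a :: "'a top"
  show "bot \<le> a" by (cases a) (simp_all add: bot_top_def)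
qed

instance top :: (bounded_lattice_bot) bounded_lattice ..

definition L2 :: "nat set top set" where
  "L2 = insert top.Top (top.Value ` {A. finite A})"

definition c2 :: "nat set top" where
  "c2 = top.Value {0}"

text \<open>The two-element lattice is \<^typ>\<open>bool\<close>.\<close>

definition CF :: "nat set set" where
  "CF = {A. finite A \<or> finite (- A)}"

definition L3 :: "(nat set \<times> bool) set" where
  "L3 = {(A, n). A \<in> CF \<and> (finite A \<or> n = True)}"

definition c3 :: "nat set \<times> bool" where
  "c3 = ({}, True)"

lemma L1_eq:
  "L1 = {{}, {y_pt}, UNIV} \<union> {z_pt ` {..n} | n. True} \<union> {insert y_pt (z_pt ` {..n}) | n. True}"
  (is "_ = ?R")
proof (intro equalityI subsetI)
  fix U assume "U \<in> ?R"
  then show "U \<in> L1"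
    by (auto simp: L1_def clopenin_Z_topology_iff is_upset_def upset_def Z1_order_def)
next
  fix U assume "U \<in> L1"
  then have cl: "clopenin Z_topology U" and up: "\<And>p q. p \<in> U \<Longrightarrow> (p, q) \<in> Z1_order \<Longrightarrow> q \<in> U"
    by (auto simp: L1_def is_upset_def upset_def)
  show "U \<in> ?R"
  proof (cases "x_pt \<in> U")
    case True
    have "p \<in> U" for p
    proof (cases p)
      case (Some q)
      then show ?thesis using True by (cases q) (auto intro!: up[OF True] simp: Z1_order_def)
    qed (use True in simp)
    then have "U = UNIV" by blast
    then show ?thesis by simp
  next
    case False
    with cl have "finite U" by (simp add: clopenin_Z_topology_iff)
    define N where "N = {n. z_pt n \<in> U}"
    have "finite (z_pt ` N)"
      using \<open>finite U\<close> by (rule rev_finite_subset) (auto simp: N_def)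
    then have "finite N"
      by (rule finite_imageD) (auto simp: inj_on_def)
    have zs: "U - {y_pt} = z_pt ` N"
    proof (intro equalityI subsetI)
      fix p assume "p \<in> U - {y_pt}"
      then show "p \<in> z_pt ` N"
        using False by (cases p; cases "the p") (auto simp: N_def)
    qed (auto simp: N_def)
    have "N = {} \<or> (\<exists>n. N = {..n})"
    proof (cases "N = {}")
      case nonempty: False
      have "m \<in> N" if "m \<le> Max N" for m
        using up[of "z_pt (Max N)" "z_pt m"] Max_in[OF \<open>finite N\<close> nonempty] that
        by (cases "m = Max N") (auto simp: N_def Z1_order_def)
      then have "N = {..Max N}" using \<open>finite N\<close> by auto
      then show ?thesis by blast
    qed simp
    moreover have "U = z_pt ` N \<or> U = insert y_pt (z_pt ` N)" using zs by blast
    ultimately show ?thesis by auto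
  qed
qed

lemma bounded_sublattice_L1: "bounded_sublattice L1"
proof -
  have "clopenin Z_topology {}" "clopenin Z_topology UNIV"
    by (simp_all add: clopenin_Z_topology_iff)
  moreover have "clopenin Z_topology (U \<inter> V)" "clopenin Z_topology (U \<union> V)"
    if "clopenin Z_topology U" "clopenin Z_topology V" for U V
    using that by (auto simp: clopenin_def)
  moreover have "is_upset Z1_order U \<longleftrightarrow> (\<forall>p q. p \<in> U \<and> (p, q) \<in> Z1_order \<longrightarrow> q \<in> U)" for U
    by (auto simp: is_upset_def upset_def Z1_order_def)
  ultimately show ?thesis
    unfolding bounded_sublattice_def L1_def by auto
qed

lemma bounded_sublattice_L2: "bounded_sublattice L2"
  unfolding bounded_sublattice_def L2_def
  by (auto simp: bot_top_def top_top_def inf_top_def sup_top_def)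

lemma bounded_sublattice_L3: "bounded_sublattice L3"
  unfolding bounded_sublattice_def L3_def CF_def
  by (auto simp: bot_prod_def top_prod_def)

end

theory Submission
  imports Defs "HOL-Library.Ramsey"
begin

text \<open>
  If the downset of \<open>stone_map a\<close> is not open, metrizability yields a sequence outside it that
  converges to some \<open>F\<close> inside it, say \<open>F \<subseteq> G\<close> with \<open>a \<in> G\<close>. By Ramsey's theorem some
  subsequence is increasing, strictly decreasing or an antichain. An increasing one would lie below
  its limit \<open>F\<close>, hence in the downset; a decreasing one lies above \<open>F\<close>; an antichain may be taken
  to lie entirely above \<open>F\<close> or to avoid the upset of \<open>F\<close>. With \<open>F\<close> as \<open>x\<close> and \<open>G\<close> as \<open>y\<close> these
  are copies of \<open>Z\<^sub>1\<close>, \<open>Z\<^sub>2\<close> and \<open>Z\<^sub>3\<close>. The dual homomorphism sends \<open>b\<close> to the preimage of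
  \<open>stone_map b\<close>, and separating disjoint compact sets by some \<open>stone_map d\<close> identifies the image of
  the annihilator of \<open>a\<close>. Conversely, the annihilator of \<open>c\<^sub>i\<close> in \<open>L\<^sub>i\<close> has no greatest element.
\<close>

section \<open>The Priestley space of a countable lattice\<close>

lemma prime_filterD:
  assumes "prime_filter F"
  shows "bot \<notin> F" "top \<in> F" "inf a b \<in> F \<longleftrightarrow> a \<in> F \<and> b \<in> F" "sup a b \<in> F \<longleftrightarrow> a \<in> F \<or> b \<in> F"
proof -
  have up: "b \<in> F" if "a \<in> F" "a \<le> b" for a b
    using assms that unfolding prime_filter_def by blast
  obtain c d where "c \<in> F" "d \<notin> F"
    using assms unfolding prime_filter_def by (metis UNIV_eq_I all_not_in_conv)
  then show "bot \<notin> F" "top \<in> F"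
    using up[of bot d] up[of c top] by auto
  have "a \<in> F \<and> b \<in> F \<longrightarrow> inf a b \<in> F" "sup a b \<in> F \<longrightarrow> a \<in> F \<or> b \<in> F"
    using assms unfolding prime_filter_def by blast+
  then show "inf a b \<in> F \<longleftrightarrow> a \<in> F \<and> b \<in> F" "sup a b \<in> F \<longleftrightarrow> a \<in> F \<or> b \<in> F"
    using up[of "inf a b"] up[of _ "sup a b"] inf_le1 inf_le2 sup_ge1 sup_ge2 by metis+
qed

text \<open>Each clause constrains only finitely many membership values. This is the form needed to
  see the prime filters as a closed set in a product of two-point spaces. Upward closure is hidden
  in the meet equivalence, as \<open>a \<le> b\<close> means \<open>inf a b = a\<close>.\<close>

lemma prime_filter_iff:
  "prime_filter F \<longleftrightarrow> bot \<notin> F \<and> top \<in> F \<and>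
     (\<forall>a b. (inf a b \<in> F \<longleftrightarrow> a \<in> F \<and> b \<in> F) \<and> (sup a b \<in> F \<longrightarrow> a \<in> F \<or> b \<in> F))"
  (is "_ \<longleftrightarrow> ?R")
proof
  assume R: ?R
  have "b \<in> F" if "a \<in> F" "a \<le> b" for a b
    using R that by (metis inf.absorb1)
  moreover have "F \<noteq> {}" "F \<noteq> UNIV" using R by auto
  ultimately show "prime_filter F"
    using R unfolding prime_filter_def by meson
qed (simp add: prime_filterD)

text \<open>Zorn's lemma gives a filter maximal among those containing \<open>a\<close> and missing
  \<open>b\<close>; distributivity makes it prime.\<close>

lemma prime_filter_theorem:
  fixes a b :: "'a::{distrib_lattice,bounded_lattice}"
  assumes "\<not> a \<le> b"
  obtains F where "prime_filter F" "a \<in> F" "b \<notin> F"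
proof -
  \<comment> \<open>The meet equivalence encodes closure under meets and upward closure at once, so
    the members of \<open>A\<close> are filters.\<close>
  define A where "A = {F. a \<in> F \<and> b \<notin> F \<and> (\<forall>x y. inf x y \<in> F \<longleftrightarrow> x \<in> F \<and> y \<in> F)}"
  have "\<exists>M\<in>A. \<forall>X\<in>A. M \<subseteq> X \<longrightarrow> X = M"
  proof (rule subset_Zorn_nonempty)
    have "{x. a \<le> x} \<in> A"
      using assms by (simp add: A_def)
    then show "A \<noteq> {}" by blast
    fix C assume C: "C \<noteq> {}" "subset.chain A C"
    then have CA: "C \<subseteq> A" and ch: "\<And>X Y. X \<in> C \<Longrightarrow> Y \<in> C \<Longrightarrow> X \<subseteq> Y \<or> Y \<subseteq> X"
      by (auto simp: subset_chain_def)
    have "inf x y \<in> \<Union>C \<longleftrightarrow> x \<in> \<Union>C \<and> y \<in> \<Union>C" for x y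
    proof
      assume "x \<in> \<Union>C \<and> y \<in> \<Union>C"
      then obtain X where "X \<in> C" "x \<in> X" "y \<in> X"
        using ch by blast
      then show "inf x y \<in> \<Union>C" using CA by (auto simp: A_def)
    qed (use CA in \<open>auto simp: A_def\<close>)
    then show "\<Union>C \<in> A"
      using C(1) CA by (auto simp: A_def)
  qed
  then obtain M where MA: "M \<in> A" and max: "\<And>X. X \<in> A \<Longrightarrow> M \<subseteq> X \<Longrightarrow> X = M"
    by blast
  have M: "a \<in> M" "b \<notin> M" "\<And>x y. inf x y \<in> M \<longleftrightarrow> x \<in> M \<and> y \<in> M"
    using MA by (auto simp: A_def)
  have up: "y \<in> M" if "x \<in> M" "x \<le> y" for x y
    using M(3)[of x y] that by (simp add: inf.absorb1)
  have ext: "\<exists>m\<in>M. inf m x \<le> b" if "x \<notin> M" for x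
  proof (rule ccontr)
    assume *: "\<not> ?thesis"
    \<comment> \<open>\<open>X\<close> is the filter generated by \<open>M\<close> and
      \<open>x\<close>. If no meet \<open>inf m x\<close> were below \<open>b\<close>, it would be a
      member of \<open>A\<close> containing \<open>M\<close> and \<open>x\<close>, against
      maximality.\<close>
    define X where "X = {z. \<exists>m\<in>M. inf m x \<le> z}"
    have "inf m m' \<in> M \<and> inf (inf m m') x \<le> inf z z'"
      if "m \<in> M" "inf m x \<le> z" "m' \<in> M" "inf m' x \<le> z'" for m m' z z'
      using that M(3) by (meson inf_le1 inf_le2 le_inf_iff order_refl order_trans)
    then have "inf z z' \<in> X \<longleftrightarrow> z \<in> X \<and> z' \<in> X" for z z'
      unfolding X_def mem_Collect_eq by (meson inf_le1 inf_le2 order_trans)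
    moreover have "M \<subseteq> X" unfolding X_def by (auto intro: le_infI1)
    ultimately have "X \<in> A" using * M(1) by (auto simp: A_def X_def)
    then have "X = M" using \<open>M \<subseteq> X\<close> by (rule max)
    moreover have "x \<in> X" unfolding X_def using M(1) by auto
    ultimately show False using that by simp
  qed
  have "x \<in> M \<or> y \<in> M" if "sup x y \<in> M" for x y
  proof (rule ccontr)
    assume "\<not> ?thesis"
    then obtain m m' where m: "m \<in> M" "m' \<in> M" "inf m x \<le> b" "inf m' y \<le> b"
      using ext by blast
    \<comment> \<open>Distributivity splits the meet with \<open>sup x y\<close> into two pieces,
      each below \<open>b\<close>; the meet itself lies in \<open>M\<close>, which would force
      \<open>b \<in> M\<close>.\<close>
    have "inf (inf m m') (sup x y) = sup (inf m' (inf m x)) (inf m (inf m' y))"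
      by (simp add: inf_sup_distrib1 ac_simps)
    also have "\<dots> \<le> b" using m by (simp add: le_infI2)
    finally show False using up M(2,3) m that by blast
  qed
  moreover have "bot \<notin> M" "top \<in> M"
    using M(1,2) up[of bot b] up[of a top] by auto
  ultimately have "prime_filter M"
    unfolding prime_filter_iff using M(3) by simp
  then show thesis using that M by blast
qed

lemma le_iff_stone_map: "a \<le> b \<longleftrightarrow> stone_map a \<subseteq> stone_map b"
proof
  show "a \<le> b \<Longrightarrow> stone_map a \<subseteq> stone_map b"
    unfolding stone_map_def prime_filter_def by blast
  show "stone_map a \<subseteq> stone_map b \<Longrightarrow> a \<le> b"
    using prime_filter_theorem[of a b] unfolding stone_map_def by blast
qed

lemma stone_map_simps [simp]:
  "stone_map bot = {}" "stone_map top = {F. prime_filter F}"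
  "stone_map (inf a b) = stone_map a \<inter> stone_map b"
  "stone_map (sup a b) = stone_map a \<union> stone_map b"
  by (auto simp: stone_map_def prime_filterD)

section \<open>The Priestley topology: basic open sets, metrizability, compactness\<close>

lemma priestley_order_iff:
  "(F, G) \<in> priestley_order \<longleftrightarrow> prime_filter F \<and> prime_filter G \<and> F \<subseteq> G"
  by (auto simp: priestley_order_def relation_of_def)

lemma openin_stone_map_Diff: "openin priestley_topology (stone_map a - stone_map b)"
  unfolding priestley_topology_def by (rule topology_generated_by_Basis) blast

lemma openin_stone_map: "openin priestley_topology (stone_map a)"
  using openin_stone_map_Diff[of a bot] by simp

lemma closedin_stone_map: "closedin priestley_topology (stone_map a)"
  using openin_stone_map_Diff[of top a] by (simp add: closedin_def) (auto simp: stone_map_def)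

lemma is_upset_stone_map: "is_upset priestley_order (stone_map a)"
  by (auto simp: is_upset_def upset_def priestley_order_iff stone_map_def)

text \<open>Passing to characteristic functions turns the basic sets into conditions on two
  coordinates, so the generated topology is that of pointwise convergence. Metrizability and
  compactness can then be read off from the product.\<close>

lemma priestley_homeomorphic:
  "(priestley_topology :: 'a set topology) homeomorphic_space
     top_of_set {p :: 'a::{distrib_lattice,bounded_lattice} \<Rightarrow> bool. prime_filter {a. p a}}"
proof -
  have "continuous_map priestley_topology euclidean (\<lambda>F a. a \<in> (F :: 'a set))"
    unfolding euclidean_product_topology [symmetric] continuous_map_componentwise_UNIV
  proof
    fix a :: 'a
    show "continuous_map priestley_topology euclidean (\<lambda>F. a \<in> F)"
      unfolding continuous_map_def
    proof (intro conjI allI impI)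
      fix U :: "bool set"
      \<comment> \<open>The preimage is split by truth value; a value outside \<open>U\<close>
        contributes \<open>stone_map bot\<close>, which is empty.\<close>
      have "{F \<in> topspace priestley_topology. (a \<in> F) \<in> U} =
          (if True \<in> U then stone_map a else stone_map bot) \<union>
          (if False \<in> U then stone_map top - stone_map a else stone_map bot)" (is "?l = ?r")
      proof (rule set_eqI)
        fix F show "F \<in> ?l \<longleftrightarrow> F \<in> ?r"
          by (cases "a \<in> F") (auto simp: stone_map_def prime_filterD)
      qed
      moreover have "openin priestley_topology \<dots>"
        by (intro openin_Un) (simp_all add: openin_stone_map openin_stone_map_Diff del: stone_map_simps)
      ultimately show "openin priestley_topology {F \<in> topspace priestley_topology. (a \<in> F) \<in> U}"
        by simp
    qed simp
  qed
  moreover have "continuous_map (top_of_set {p. prime_filter {a. p a}}) priestley_topology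
     (\<lambda>p::'a \<Rightarrow> bool. {a. p a})"
    unfolding priestley_topology_def
  proof (rule continuous_on_generated_topo)
    fix U :: "'a set set" assume "U \<in> {stone_map a - stone_map b |a b. True}"
    then obtain a b :: 'a where U: "U = stone_map a - stone_map b" by blast
    have "open {p::'a \<Rightarrow> bool. p a \<and> \<not> p b}"
    proof -
      have "open ((\<lambda>p. p a) -` {True} \<inter> (\<lambda>p::'a \<Rightarrow> bool. p b) -` {False})"
        by (intro open_Int open_vimage open_discrete continuous_on_product_coordinates)
      moreover have "(\<lambda>p. p a) -` {True} \<inter> (\<lambda>p::'a \<Rightarrow> bool. p b) -` {False} = {p. p a \<and> \<not> p b}"
        by auto
      ultimately show ?thesis by simp
    qed
    moreover have "(\<lambda>p. {a. p a}) -` U \<inter> {p. prime_filter {a. p a}} =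
        {p. prime_filter {a. p a}} \<inter> {p. p a \<and> \<not> p b}"
      by (auto simp: U stone_map_def)
    ultimately show "openin (top_of_set {p. prime_filter {a. p a}})
        ((\<lambda>p. {a. p a}) -` U \<inter> topspace (top_of_set {p. prime_filter {a. p a}}))"
      by (auto simp: openin_open_Int)
  next
    show "(\<lambda>p. {a. p a}) ` topspace (top_of_set {p. prime_filter {a. p a}}) \<subseteq>
      \<Union> {stone_map a - stone_map b |a b :: 'a. True}"
    proof safe
      fix p assume "p \<in> topspace (top_of_set {p. prime_filter {a::'a. p a}})"
      then have "{a. p a} \<in> stone_map top - stone_map bot" by simp
      then show "{a. p a} \<in> \<Union> {stone_map a - stone_map b |a b :: 'a. True}" by blast
    qed
  qed
  ultimately have "homeomorphic_maps priestley_topology (top_of_set {p. prime_filter {a. p a}})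
     (\<lambda>F a. a \<in> F) (\<lambda>p::'a \<Rightarrow> bool. {a. p a})"
    unfolding homeomorphic_maps_def by (auto simp: continuous_map_in_subtopology)
  then show ?thesis
    by (rule homeomorphic_maps_imp_homeomorphic_space)
qed

text \<open>Countability enters here: a countable product of discrete two-point spaces is
  metrizable, and so are its subspaces.\<close>

lemma metrizable_priestley_topology:
  assumes "countable (UNIV :: 'a::{distrib_lattice,bounded_lattice} set)"
  shows "metrizable_space (priestley_topology :: 'a set topology)"
proof -
  have "(euclidean :: bool topology) = discrete_topology UNIV"
    by (simp add: topology_eq open_discrete)
  then have bool: "metrizable_space (euclidean :: bool topology)"
    by simp
  have "metrizable_space (euclidean :: ('a \<Rightarrow> bool) topology)"
    unfolding euclidean_product_topology [symmetric] metrizable_space_product_topology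
    by (intro disjI2 conjI ballI countable_subset[OF subset_UNIV assms] bool)
  then show ?thesis
    using homeomorphic_metrizable_space priestley_homeomorphic metrizable_space_subtopology by blast
qed

text \<open>The prime filters form a closed subset of a product that is compact by Tychonoff's
  theorem.\<close>

lemma compact_space_priestley_topology:
  "compact_space (priestley_topology :: 'a::{distrib_lattice,bounded_lattice} set topology)"
proof -
  have "compact_space (euclidean :: ('a \<Rightarrow> bool) topology)"
    unfolding euclidean_product_topology [symmetric] compact_space_product_topology
    by (simp add: compact_space_def finite_imp_compact)
  then have compact_UNIV: "compact (UNIV :: ('a \<Rightarrow> bool) set)"
    by (simp add: compact_space_def)
  have "open {p::'a \<Rightarrow> bool. p a}" "open {p::'a \<Rightarrow> bool. \<not> p a}" for a
  proof -
    have "open ((\<lambda>p::'a \<Rightarrow> bool. p a) -` {b})" for b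
      by (intro open_vimage open_discrete continuous_on_product_coordinates)
    from this[of True] this[of False]
    show "open {p::'a \<Rightarrow> bool. p a}" "open {p::'a \<Rightarrow> bool. \<not> p a}"
      by (simp_all add: vimage_def)
  qed
  then have "closed {p::'a \<Rightarrow> bool. p a}" "closed {p::'a \<Rightarrow> bool. \<not> p a}" for a
    by (simp_all add: closed_def Collect_neg_eq [symmetric])
  \<comment> \<open>The conditions are rewritten as conjunctions of disjunctions of coordinates and
    negated coordinates, all of which define closed sets.\<close>
  then have "closed {p. \<not> p bot \<and> p top \<and>
      (\<forall>a b. (\<not> p (inf a b) \<or> p a \<and> p b) \<and> (p (inf a b) \<or> \<not> p a \<or> \<not> p b) \<and>
             (\<not> p (sup a b) \<or> p a \<or> p (b :: 'a)))}" (is "closed {p. ?R p}")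
    by (intro closed_Collect_conj closed_Collect_all closed_Collect_disj)
  moreover have "prime_filter {a. p a} \<longleftrightarrow> ?R p" for p
    unfolding prime_filter_iff mem_Collect_eq by meson
  ultimately have "closed {p :: 'a \<Rightarrow> bool. prime_filter {a. p a}}"
    by simp
  with compact_UNIV have "compact {p :: 'a \<Rightarrow> bool. prime_filter {a. p a}}"
    using compact_Int_closed by fastforce
  then have "compact_space (top_of_set {p :: 'a \<Rightarrow> bool. prime_filter {a. p a}})"
    by (simp add: compact_space_subtopology)
  then show ?thesis
    using homeomorphic_compact_space priestley_homeomorphic by blast
qed

section \<open>Downsets of clopen upsets\<close>

text \<open>Two compactness arguments. For fixed \<open>F \<in> K\<close>, finitely many elements of
  \<open>F\<close> suffice to exclude all of \<open>K'\<close>, and their meet is a single one. The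
  resulting sets cover \<open>K\<close>, and a finite join unites them. This is the tool for
  producing lattice elements with prescribed behaviour.\<close>

lemma compactin_stone_map_separation:
  assumes K: "compactin priestley_topology K" and K': "compactin priestley_topology K'"
    and sep: "\<And>F G. F \<in> K \<Longrightarrow> G \<in> K' \<Longrightarrow> \<not> F \<subseteq> G"
  obtains b :: "'a::{distrib_lattice,bounded_lattice}"
    where "K \<subseteq> stone_map b" "stone_map b \<inter> K' = {}"
proof -
  have pf: "prime_filter F" if "F \<in> K \<or> F \<in> K'" for F
    using compactin_subset_topspace[OF K] compactin_subset_topspace[OF K'] that by auto
  have ex: "\<exists>b\<in>F. stone_map b \<inter> K' = {}" if F: "F \<in> K" for F
  proof -
    let ?U = "\<lambda>b::'a. stone_map top - stone_map b"
    \<comment> \<open>Every \<open>G \<in> K'\<close> omits some \<open>b \<in> F\<close>, since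
      \<open>F\<close> is not included in \<open>G\<close>.\<close>
    have "K' \<subseteq> \<Union>(?U ` F)"
      using sep[OF F] pf by (auto simp: stone_map_def prime_filterD)
    then obtain \<F> where "finite \<F>" "\<F> \<subseteq> ?U ` F" "K' \<subseteq> \<Union>\<F>"
      using compactinD[OF K', of "?U ` F"] openin_stone_map_Diff by blast
    then obtain B where B: "finite B" "B \<subseteq> F" "K' \<subseteq> \<Union>(?U ` B)"
      by (metis finite_subset_image)
    from B(1,2) have "\<exists>b\<in>F. stone_map b \<subseteq> (\<Inter>c\<in>B. stone_map c)"
    proof induction
      case empty
      then show ?case using pf[of F] F prime_filterD(2) by auto
    next
      case (insert c B)
      then obtain b where "b \<in> F" "stone_map b \<subseteq> (\<Inter>c\<in>B. stone_map c)" by blast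
      moreover have "inf c b \<in> F"
        using insert.prems \<open>b \<in> F\<close> pf[of F] F by (simp add: prime_filterD)
      ultimately show ?case by (intro bexI[of _ "inf c b"]) auto
    qed
    then show ?thesis using B(3) by blast
  qed
  define S where "S = {b::'a. stone_map b \<inter> K' = {}}"
  have "K \<subseteq> \<Union>(stone_map ` S)"
    using ex pf by (fastforce simp: S_def stone_map_def)
  then obtain \<F> where "finite \<F>" "\<F> \<subseteq> stone_map ` S" "K \<subseteq> \<Union>\<F>"
    using compactinD[OF K, of "stone_map ` S"] openin_stone_map by blast
  then obtain B where B: "finite B" "B \<subseteq> S" "K \<subseteq> \<Union>(stone_map ` B)"
    by (metis finite_subset_image)
  from B(1,2) have "\<exists>b\<in>S. (\<Union>c\<in>B. stone_map c) \<subseteq> stone_map b"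
  proof induction
    case empty
    then show ?case by (auto simp: S_def intro: exI[of _ bot])
  next
    case (insert c B)
    then obtain b where "b \<in> S" "(\<Union>c\<in>B. stone_map c) \<subseteq> stone_map b" by blast
    moreover have "sup c b \<in> S"
      using insert.prems \<open>b \<in> S\<close> by (auto simp: S_def)
    ultimately show ?case by (intro bexI[of _ "sup c b"]) auto
  qed
  then obtain b where "b \<in> S" "(\<Union>c\<in>B. stone_map c) \<subseteq> stone_map b" by blast
  then show thesis using that[of b] B(3) unfolding S_def by blast
qed

lemma inf_eq_bot_iff_stone_map: "inf d a = bot \<longleftrightarrow> (\<forall>F\<in>stone_map a. d \<notin> F)"
proof -
  have "inf d a = bot \<longleftrightarrow> stone_map d \<inter> stone_map a = {}"
    using le_iff_stone_map[of "inf d a" bot] by (simp add: bot_unique)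
  then show ?thesis by (auto simp: stone_map_def)
qed

lemma compactin_stone_map: "compactin priestley_topology (stone_map a)"
  using closedin_stone_map closedin_compact_space compact_space_priestley_topology by blast

text \<open>The complement of the downset of \<open>stone_map a\<close> is then compact, and no
  point of it lies below a point of \<open>stone_map a\<close>. A separating element
  \<open>d\<close> is the pseudocomplement of \<open>a\<close>.\<close>

lemma p_algebra_if_open_downsets:
  assumes "\<And>a::'a::{distrib_lattice,bounded_lattice}.
    openin priestley_topology (downset priestley_order (stone_map a))"
  shows "p_algebra TYPE('a)"
  unfolding p_algebra_def
proof
  fix a :: 'a
  define C where "C = topspace priestley_topology - downset priestley_order (stone_map a)"
  have C: "F \<in> C \<longleftrightarrow> prime_filter F \<and> (\<forall>G\<in>stone_map a. \<not> F \<subseteq> G)" for F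
    by (auto simp: C_def downset_def priestley_order_iff stone_map_def)
  have "closedin priestley_topology C"
    unfolding C_def using assms[of a] by (intro closedin_diff closedin_topspace)
  then have "compactin priestley_topology C"
    using closedin_compact_space compact_space_priestley_topology by blast
  moreover have "\<not> F \<subseteq> G" if "F \<in> C" "G \<in> stone_map a" for F G
    using that C by blast
  ultimately obtain d where d: "C \<subseteq> stone_map d" "stone_map d \<inter> stone_map a = {}"
    by (rule compactin_stone_map_separation[OF _ compactin_stone_map])
  have "e \<le> d" if "inf e a = bot" for e
  proof -
    \<comment> \<open>A filter containing \<open>e\<close> and lying below some \<open>G\<close>
      that contains \<open>a\<close> would put \<open>e\<close> into \<open>G\<close>, contradicting
      \<open>inf e a = bot\<close>.\<close>
    have "stone_map e \<subseteq> C"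
      using that unfolding inf_eq_bot_iff_stone_map C subset_iff by (simp add: stone_map_def) blast
    then show ?thesis using d(1) le_iff_stone_map by blast
  qed
  moreover have "inf d a = bot"
    using d(2) by (intro inf_eq_bot_iff_stone_map[THEN iffD2]) (auto simp: stone_map_def)
  ultimately show "\<exists>d. inf d a = bot \<and> (\<forall>e. inf e a = bot \<longrightarrow> e \<le> d)"
    by blast
qed

lemma priestley_space_prime_filters: "priestley_space priestley_topology priestley_order"
  unfolding priestley_space_def
proof (intro conjI ballI impI)
  show "partial_order_on (topspace priestley_topology) priestley_order"
    by (auto simp: partial_order_on_def preorder_on_def refl_on_def trans_def antisym_def priestley_order_iff)
next
  fix F G :: "'a set"
  assume "F \<in> topspace priestley_topology" "G \<in> topspace priestley_topology" "(F, G) \<notin> priestley_order"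
  then obtain a where "F \<in> stone_map a" "G \<notin> stone_map a"
    by (auto simp: priestley_order_iff stone_map_def)
  then show "\<exists>U. clopenin priestley_topology U \<and> is_upset priestley_order U \<and> F \<in> U \<and> G \<notin> U"
    unfolding clopenin_def using openin_stone_map closedin_stone_map is_upset_stone_map by blast
qed (rule compact_space_priestley_topology)

text \<open>An open upset is a union of sets \<open>stone_map a\<close>, and downsets commute with
  unions, so the clopen case suffices.\<close>

lemma p_space_if_open_downsets:
  assumes "\<And>a::'a::{distrib_lattice,bounded_lattice}.
    openin priestley_topology (downset priestley_order (stone_map a))"
  shows "p_space (priestley_topology :: 'a set topology) priestley_order"
  unfolding p_space_def
proof (intro conjI allI impI priestley_space_prime_filters)
  fix U :: "'a set set" assume U: "openin priestley_topology U \<and> is_upset priestley_order U"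
  let ?S = "{a. stone_map a \<subseteq> U}"
  have "\<exists>a\<in>?S. F \<in> stone_map a" if F: "F \<in> U" for F
  proof -
    have "prime_filter F" using openin_subset[of priestley_topology U] U F by auto
    have "compactin priestley_topology {F}"
      using \<open>prime_filter F\<close> by simp
    moreover have "closedin priestley_topology (topspace priestley_topology - U)"
      using U by (intro closedin_diff closedin_topspace) simp
    then have "compactin priestley_topology (topspace priestley_topology - U)"
      using closedin_compact_space compact_space_priestley_topology by blast
    \<comment> \<open>As \<open>U\<close> is an upset, nothing above \<open>F\<close> lies outside
      it, so the point can be separated from the complement of \<open>U\<close>.\<close>
    moreover have "\<not> F' \<subseteq> G" if "F' \<in> {F}" "G \<in> topspace priestley_topology - U" for F' G
      using that U F \<open>prime_filter F\<close> by (auto simp: is_upset_def upset_def priestley_order_iff)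
    ultimately obtain a where "{F} \<subseteq> stone_map a" "stone_map a \<inter> (topspace priestley_topology - U) = {}"
      by (rule compactin_stone_map_separation)
    then show ?thesis by (auto simp: stone_map_def)
  qed
  then have "downset priestley_order U = (\<Union>a\<in>?S. downset priestley_order (stone_map a))"
    unfolding downset_def by blast
  then show "openin priestley_topology (downset priestley_order U)"
    using assms by auto
qed

section \<open>Obstructions in p-spaces and p-algebras\<close>

lemma embedding_map_imp_continuous_map: "embedding_map X Y f \<Longrightarrow> continuous_map X Y f"
  unfolding embedding_map_def
  using homeomorphic_imp_continuous_map continuous_map_into_fulltopology by blast

text \<open>Continuity would make \<open>{x_pt, y_pt}\<close> open, but every neighbourhood of the
  limit point \<open>x_pt\<close> is cofinite. The order \<open>s\<close> is arbitrary.\<close>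

lemma p_space_no_p_configuration:
  assumes "p_space T r"
  shows "\<not> p_configuration s T r"
proof
  assume "p_configuration s T r"
  then obtain e U where e: "embedding_map Z_topology T e" and U: "openin T U" "is_upset r U"
    and pre: "e -` downset r U = {x_pt, y_pt}"
    unfolding p_configuration_def by blast
  have "openin T (downset r U)"
    using assms U unfolding p_space_def by blast
  then have "openin Z_topology {p \<in> topspace Z_topology. e p \<in> downset r U}"
    using e by (intro openin_continuous_map_preimage embedding_map_imp_continuous_map)
  then have "openin Z_topology {x_pt, y_pt}"
    unfolding pre [symmetric] by (simp add: vimage_def)
  then have "finite (- {x_pt, y_pt})"
    by (simp add: openin_Z_topology_iff)
  then have "finite (range z_pt)"
    by (rule rev_finite_subset) auto
  then show False
    by (simp add: finite_image_iff inj_on_def)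
qed

text \<open>The annihilator of \<open>a\<close> is the principal ideal below its pseudocomplement
  \<open>d\<close>, and a homomorphism preserves order, so \<open>h d\<close> is greatest in the
  image.\<close>

lemma p_algebra_annihilator_has_greatest:
  assumes "p_algebra TYPE('a::{distrib_lattice,bounded_lattice})"
    and "onto_bounded_lattice_hom (h :: 'a \<Rightarrow> 'b::bounded_lattice) M"
    and "h ` rel_annihilator UNIV a bot = rel_annihilator M c bot"
  obtains m where "m \<in> rel_annihilator M c bot" "\<And>n. n \<in> rel_annihilator M c bot \<Longrightarrow> n \<le> m"
proof -
  obtain d where d: "inf d a = bot" "\<And>e. inf e a = bot \<Longrightarrow> e \<le> d"
    using assms(1) unfolding p_algebra_def by blast
  have "h e \<le> h d" if "e \<le> d" for e
    using that assms(2) unfolding onto_bounded_lattice_hom_def by (metis inf.absorb_iff1)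
  then have "n \<le> h d" if "n \<in> h ` rel_annihilator UNIV a bot" for n
    using that d(2) by (auto simp: rel_annihilator_def bot_unique)
  moreover have "h d \<in> h ` rel_annihilator UNIV a bot"
    using d(1) by (simp add: rel_annihilator_def)
  ultimately show thesis
    using that assms(3) by auto
qed

section \<open>Embedded copies of the spaces \<open>Z\<^sub>i\<close>\<close>

lemma zpoint_cases:
  obtains "p = x_pt" | "p = y_pt" | n where "p = z_pt n"
  by (metis isolated_point.exhaust option.exhaust)

lemma decreasing_or_increasing_or_antichain_subsequence:
  fixes \<sigma> :: "nat \<Rightarrow> 'b::order"
  obtains \<rho> :: "nat \<Rightarrow> nat" where "strict_mono \<rho>"
    "(\<forall>i j. i < j \<longrightarrow> \<sigma> (\<rho> i) \<le> \<sigma> (\<rho> j)) \<or> (\<forall>i j. i < j \<longrightarrow> \<sigma> (\<rho> j) < \<sigma> (\<rho> i)) \<or>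
     (\<forall>i j. i \<noteq> j \<longrightarrow> \<not> \<sigma> (\<rho> i) \<le> \<sigma> (\<rho> j))"
proof -
  \<comment> \<open>Three colours for pairs of indices, read in increasing order of index: weakly
    increasing values, strictly decreasing values, incomparable values. Equal values receive the
    first colour.\<close>
  define c where "c X = (if \<sigma> (Min X) \<le> \<sigma> (Max X) then 0 else if \<sigma> (Max X) < \<sigma> (Min X) then 1 else 2::nat)"
    for X
  have "\<exists>Y t. Y \<subseteq> UNIV \<and> infinite Y \<and> t < 3 \<and> (\<forall>x\<in>Y. \<forall>y\<in>Y. x \<noteq> y \<longrightarrow> c {x, y} = t)"
    by (rule Ramsey2[OF infinite_UNIV_nat]) (simp add: c_def)
  then obtain Y t where Y: "infinite Y" and t: "\<forall>x\<in>Y. \<forall>y\<in>Y. x \<noteq> y \<longrightarrow> c {x, y} = t"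
    by (elim exE conjE)
  define \<rho> where "\<rho> = enumerate Y"
  have \<rho>: "strict_mono \<rho>"
    unfolding \<rho>_def using Y by (rule strict_mono_enumerate)
  have col: "t = 0 \<and> \<sigma> (\<rho> i) \<le> \<sigma> (\<rho> j) \<or> t = 1 \<and> \<sigma> (\<rho> j) < \<sigma> (\<rho> i) \<or>
      t = 2 \<and> \<not> \<sigma> (\<rho> i) \<le> \<sigma> (\<rho> j) \<and> \<not> \<sigma> (\<rho> j) \<le> \<sigma> (\<rho> i)" if "i < j" for i j
  proof -
    have ij: "\<rho> i < \<rho> j" using \<rho> that by (simp add: strict_mono_less)
    then have mm: "Min {\<rho> i, \<rho> j} = \<rho> i" "Max {\<rho> i, \<rho> j} = \<rho> j"
      by simp_all
    have "\<rho> i \<in> Y" "\<rho> j \<in> Y"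
      unfolding \<rho>_def using Y by (simp_all add: enumerate_in_set)
    then have t_eq: "t = (if \<sigma> (\<rho> i) \<le> \<sigma> (\<rho> j) then 0 else if \<sigma> (\<rho> j) < \<sigma> (\<rho> i) then 1 else 2)"
      using t[rule_format, of "\<rho> i" "\<rho> j"] ij unfolding c_def mm by simp
    consider "\<sigma> (\<rho> i) \<le> \<sigma> (\<rho> j)" | "\<sigma> (\<rho> j) < \<sigma> (\<rho> i)" | "\<not> \<sigma> (\<rho> i) \<le> \<sigma> (\<rho> j)" "\<not> \<sigma> (\<rho> j) \<le> \<sigma> (\<rho> i)"
      by (meson less_le_not_le)
    then show ?thesis
      by cases (simp_all add: t_eq less_le_not_le)
  qed
  consider "t = 0" | "t = 1" | "t \<noteq> 0" "t \<noteq> 1" by blast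
  then show thesis
  proof cases
    case 1
    have "\<sigma> (\<rho> i) \<le> \<sigma> (\<rho> j)" if "i < j" for i j
      using col[OF that] 1 by simp
    then show ?thesis by (intro that[OF \<rho>] disjI1) simp
  next
    case 2
    have "\<sigma> (\<rho> j) < \<sigma> (\<rho> i)" if "i < j" for i j
      using col[OF that] 2 by simp
    then show ?thesis by (intro that[OF \<rho>] disjI2[OF disjI1]) simp
  next
    case 3
    have *: "\<not> \<sigma> (\<rho> i) \<le> \<sigma> (\<rho> j) \<and> \<not> \<sigma> (\<rho> j) \<le> \<sigma> (\<rho> i)" if "i < j" for i j
      using col[OF that] 3 by simp
    have "\<not> \<sigma> (\<rho> i) \<le> \<sigma> (\<rho> j)" if "i \<noteq> j" for i j
      using that *[of i j] *[of j i] by (cases i j rule: linorder_cases) simp_all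
    then show ?thesis by (intro that[OF \<rho>] disjI2[OF disjI2]) simp
  qed
qed

lemma subsequence_all_or_none:
  fixes P :: "nat \<Rightarrow> bool"
  obtains \<rho> :: "nat \<Rightarrow> nat" where "strict_mono \<rho>" "(\<forall>n. P (\<rho> n)) \<or> (\<forall>n. \<not> P (\<rho> n))"
proof (cases "infinite {n. P n}")
  case True
  then show thesis
    using that[of "enumerate {n. P n}"] strict_mono_enumerate enumerate_in_set by blast
next
  case False
  have "infinite (- {n. P n})"
    using False by (metis finite_compl infinite_UNIV_nat)
  then show thesis
    using that[of "enumerate (- {n. P n})"] strict_mono_enumerate enumerate_in_set by blast
qed

text \<open>All points but \<open>x_pt\<close> are isolated, so continuity only needs convergence of
  the \<open>z_pt n\<close>, which \<open>lim\<close> states element by element.\<close>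

lemma embedding_map_Z_topology:
  fixes e :: "zpoint \<Rightarrow> 'a::{distrib_lattice,bounded_lattice} set"
  assumes haus: "Hausdorff_space (priestley_topology :: 'a set topology)"
    and pf: "\<And>p. prime_filter (e p)" and inj: "inj e"
    and lim: "\<And>b. eventually (\<lambda>n. b \<in> e (z_pt n) \<longleftrightarrow> b \<in> e x_pt) sequentially"
  shows "embedding_map Z_topology priestley_topology e"
proof -
  have "continuous_map Z_topology priestley_topology e"
    unfolding priestley_topology_def
  proof (rule continuous_on_generated_topo)
    fix U :: "'a set set" assume "U \<in> {stone_map a - stone_map b |a b. True}"
    then obtain a b :: 'a where "U = stone_map a - stone_map b" by blast
    then have U: "e p \<in> U \<longleftrightarrow> a \<in> e p \<and> b \<notin> e p" for p
      using pf by (auto simp: stone_map_def)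
    have "finite (- (e -` U))" if "e x_pt \<in> U"
    proof -
      have "eventually (\<lambda>n. e (z_pt n) \<in> U) sequentially"
        using lim[of a] lim[of b] by eventually_elim (use that in \<open>simp add: U\<close>)
      then obtain N where N: "\<And>n. n \<ge> N \<Longrightarrow> e (z_pt n) \<in> U"
        unfolding eventually_sequentially by blast
      \<comment> \<open>Besides \<open>y_pt\<close>, only the \<open>z_pt n\<close> before the
        threshold \<open>N\<close> can be mapped outside \<open>U\<close>.\<close>
      have "- (e -` U) \<subseteq> insert y_pt (z_pt ` {..<N})"
      proof
        fix p assume p: "p \<in> - (e -` U)"
        show "p \<in> insert y_pt (z_pt ` {..<N})"
        proof (cases p)
          case None
          then show ?thesis using p that by simp
        next
          case (Some q)
          then show ?thesis using p N by (cases q) (auto simp: not_less [symmetric])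
        qed
      qed
      then show ?thesis by (rule finite_subset) simp
    qed
    then show "openin Z_topology (e -` U \<inter> topspace Z_topology)"
      by (simp add: openin_Z_topology_iff)
  next
    have "e p \<in> stone_map top - stone_map bot" for p
      using pf by simp
    then show "e ` topspace Z_topology \<subseteq> \<Union> {stone_map a - stone_map b |a b. True}"
      by blast
  qed
  \<comment> \<open>A continuous map from a compact space to a Hausdorff space is closed.\<close>
  moreover from this have "closed_map Z_topology priestley_topology e"
    using haus compact_space_Z_topology
    by (simp add: continuous_imp_closed_map_gen Hausdorff_imp_kc_space)
  ultimately show ?thesis
    using inj by (simp add: injective_closed_imp_embedding_map)
qed

text \<open>In a metrizable space, a set that is not closed contains a sequence converging to a
  point outside it; this is applied to the complement of the downset.\<close>

lemma not_open_downset_sequence: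
  fixes a :: "'a::{distrib_lattice,bounded_lattice}"
  assumes "metrizable_space (priestley_topology :: 'a set topology)"
    and "\<not> openin priestley_topology (downset priestley_order (stone_map a))"
  obtains F G \<sigma> where "prime_filter F" "G \<in> stone_map a" "F \<subseteq> G"
    "\<And>n. prime_filter (\<sigma> n)" "\<And>n H. H \<in> stone_map a \<Longrightarrow> \<not> \<sigma> n \<subseteq> H"
    "\<And>b. eventually (\<lambda>n. b \<in> \<sigma> n \<longleftrightarrow> b \<in> F) sequentially"
proof -
  let ?D = "downset priestley_order (stone_map a)"
  obtain M d where Md: "Metric_space M d" "(priestley_topology :: 'a set topology) = Metric_space.mtopology M d"
    using assms(1) unfolding metrizable_space_def by blast
  have D: "F \<in> ?D \<longleftrightarrow> prime_filter F \<and> (\<exists>G\<in>stone_map a. F \<subseteq> G)" for F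
    by (auto simp: downset_def priestley_order_iff stone_map_def)
  have "?D \<subseteq> topspace priestley_topology"
    by (auto simp: D)
  then have "\<not> closedin priestley_topology (topspace priestley_topology - ?D)"
    using assms(2) openin_closedin_eq by blast
  moreover have "topspace priestley_topology - ?D \<subseteq> M"
    using Md by (metis Diff_subset Metric_space.topspace_mtopology)
  ultimately obtain \<sigma> F where ran: "range \<sigma> \<subseteq> topspace priestley_topology - ?D"
    and lim: "limitin priestley_topology \<sigma> F sequentially" and F: "F \<notin> topspace priestley_topology - ?D"
    using Metric_space.metric_closedin_iff_sequentially_closed[OF Md(1)] unfolding Md(2) by blast
  have \<sigma>: "prime_filter (\<sigma> n)" "\<sigma> n \<notin> ?D" for n
    using ran by auto
  have FT: "prime_filter F"
    using limitin_topspace[OF lim] by simp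
  \<comment> \<open>The limit is tested against \<open>stone_map b\<close> or against its
    complement, whichever contains \<open>F\<close>; both are open.\<close>
  have "eventually (\<lambda>n. b \<in> \<sigma> n \<longleftrightarrow> b \<in> F) sequentially" for b
  proof (cases "b \<in> F")
    case True
    then have "eventually (\<lambda>n. \<sigma> n \<in> stone_map b) sequentially"
      using lim openin_stone_map[of b] FT unfolding limitin_def by (auto simp: stone_map_def)
    then show ?thesis
      by eventually_elim (use True in \<open>simp add: stone_map_def\<close>)
  next
    case False
    then have "eventually (\<lambda>n. \<sigma> n \<in> stone_map top - stone_map b) sequentially"
      using lim openin_stone_map_Diff[of top b] FT unfolding limitin_def
      by (auto simp: stone_map_def prime_filterD)
    then show ?thesis
      by eventually_elim (use False in \<open>auto simp: stone_map_def\<close>)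
  qed
  moreover obtain G where "G \<in> stone_map a" "F \<subseteq> G"
    using F FT D by auto
  ultimately show thesis
    using that FT \<sigma> D by blast
qed

text \<open>The same embedding serves both equivalences, and the open upset of the configuration is
  \<open>stone_map a\<close> itself.\<close>

lemma not_open_downset_Z_embedding:
  fixes a :: "'a::{distrib_lattice,bounded_lattice}"
  assumes metr: "metrizable_space (priestley_topology :: 'a set topology)"
    and "\<not> openin priestley_topology (downset priestley_order (stone_map a))"
  obtains s e where "s \<in> {Z1_order, Z2_order, Z3_order}"
    "embedding_map Z_topology priestley_topology e"
    "\<forall>u v. (u, v) \<in> s \<longleftrightarrow> (e u, e v) \<in> priestley_order"
    "e y_pt \<in> stone_map a"
    "e -` downset priestley_order (stone_map a) = {x_pt, y_pt}"
proof -
  obtain F G \<sigma> where F: "prime_filter F" and G: "G \<in> stone_map a" and FG: "F \<subseteq> G"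
    and \<sigma>: "\<And>n. prime_filter (\<sigma> n)" "\<And>n H. H \<in> stone_map a \<Longrightarrow> \<not> \<sigma> n \<subseteq> H"
    and lim: "\<And>b. eventually (\<lambda>n. b \<in> \<sigma> n \<longleftrightarrow> b \<in> F) sequentially"
    using not_open_downset_sequence[OF assms] by blast
  obtain \<rho>1 :: "nat \<Rightarrow> nat" where \<rho>1: "strict_mono \<rho>1" and mono: "(\<forall>i j. i < j \<longrightarrow> \<sigma> (\<rho>1 i) \<le> \<sigma> (\<rho>1 j)) \<or>
      (\<forall>i j. i < j \<longrightarrow> \<sigma> (\<rho>1 j) < \<sigma> (\<rho>1 i)) \<or> (\<forall>i j. i \<noteq> j \<longrightarrow> \<not> \<sigma> (\<rho>1 i) \<le> \<sigma> (\<rho>1 j))"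
    by (rule decreasing_or_increasing_or_antichain_subsequence)
  \<comment> \<open>A second thinning makes the comparison with \<open>F\<close> uniform, which is
    what distinguishes \<open>Z2_order\<close> from \<open>Z3_order\<close>; the order pattern of
    the first survives it.\<close>
  obtain \<rho>2 :: "nat \<Rightarrow> nat" where \<rho>2: "strict_mono \<rho>2" and above:
      "(\<forall>n. F \<subseteq> \<sigma> (\<rho>1 (\<rho>2 n))) \<or> (\<forall>n. \<not> F \<subseteq> \<sigma> (\<rho>1 (\<rho>2 n)))"
    by (rule subsequence_all_or_none)
  define \<tau> where "\<tau> n = \<sigma> (\<rho>1 (\<rho>2 n))" for n
  have \<tau>: "prime_filter (\<tau> n)" "H \<in> stone_map a \<Longrightarrow> \<not> \<tau> n \<subseteq> H" for n H
    using \<sigma> by (auto simp: \<tau>_def)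
  have lim\<tau>: "eventually (\<lambda>n. b \<in> \<tau> n \<longleftrightarrow> b \<in> F) sequentially" for b
    using eventually_subseq[OF strict_mono_o[OF \<rho>1 \<rho>2] lim[of b]] by (simp add: \<tau>_def)
  have far: "\<exists>j>i. b \<in> \<tau> j \<longleftrightarrow> b \<in> F" for i b
    using eventually_conj[OF lim\<tau>[of b] eventually_gt_at_top[of i]]
    by (auto dest: eventually_happens)
  \<comment> \<open>Along an increasing sequence, each element of a term stays in all later terms
    and hence belongs to the limit \<open>F\<close>.\<close>
  have not_inc: "\<not> (\<forall>i j. i < j \<longrightarrow> \<tau> i \<subseteq> \<tau> j)"
  proof
    assume "\<forall>i j. i < j \<longrightarrow> \<tau> i \<subseteq> \<tau> j"
    then have "\<tau> 0 \<subseteq> F" using far by blast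
    then show False using \<tau>(2)[OF G] FG by blast
  qed
  have "a \<notin> F"
  proof
    assume "a \<in> F"
    then obtain j where "a \<in> \<tau> j" using far by blast
    then show False using \<tau> by (auto simp: stone_map_def)
  qed
  have "a \<in> G" "prime_filter G"
    using G by (auto simp: stone_map_def)
  have a\<tau>: "a \<notin> \<tau> n" for n
    using \<tau> by (auto simp: stone_map_def)
  define e where "e p = (case p of None \<Rightarrow> F | Some Iso_y \<Rightarrow> G | Some (Iso_z n) \<Rightarrow> \<tau> n)" for p
  have e [simp]: "e x_pt = F" "e y_pt = G" "e (z_pt n) = \<tau> n" for n
    by (auto simp: e_def)
  have pf: "prime_filter (e p)" for p
    using F \<open>prime_filter G\<close> \<tau>(1) by (auto simp: e_def split: option.split isolated_point.split)
  \<comment> \<open>The element \<open>a\<close> lies in \<open>G\<close> but not in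
    \<open>F\<close> or any \<open>\<tau> n\<close>; and no \<open>\<tau> n\<close> lies below
    \<open>G\<close>, hence none below \<open>F\<close>. Left open are only the comparisons within
    the sequence and of \<open>F\<close> with it.\<close>
  have table: "\<not> G \<subseteq> F" "\<not> G \<subseteq> \<tau> n" "\<not> \<tau> n \<subseteq> F" "\<not> \<tau> n \<subseteq> G" for n
    using \<open>a \<in> G\<close> \<open>a \<notin> F\<close> a\<tau> \<tau>(2)[OF G] FG by blast+
  have "\<exists>s\<in>{Z1_order, Z2_order, Z3_order}. \<forall>u v. (u, v) \<in> s \<longleftrightarrow> e u \<subseteq> e v"
  proof -
    consider (dec) "\<And>i j. i < j \<Longrightarrow> \<tau> j \<subset> \<tau> i"
      | (anti) "\<And>i j. i \<noteq> j \<Longrightarrow> \<not> \<tau> i \<subseteq> \<tau> j"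
      using mono
    proof (elim disjE)
      assume "\<forall>i j. i < j \<longrightarrow> \<sigma> (\<rho>1 i) \<le> \<sigma> (\<rho>1 j)"
      then show thesis
        using not_inc \<rho>2 by (simp add: \<tau>_def strict_mono_less)
    next
      assume "\<forall>i j. i < j \<longrightarrow> \<sigma> (\<rho>1 j) < \<sigma> (\<rho>1 i)"
      then show thesis
        using dec \<rho>2 by (simp add: \<tau>_def strict_mono_less)
    next
      assume "\<forall>i j. i \<noteq> j \<longrightarrow> \<not> \<sigma> (\<rho>1 i) \<le> \<sigma> (\<rho>1 j)"
      then show thesis
        using anti \<rho>2 by (simp add: \<tau>_def strict_mono_eq)
    qed
    then show ?thesis
    proof cases
      case dec
      \<comment> \<open>An element of \<open>F\<close> occurs in some later term, and later terms
        are contained in \<open>\<tau> n\<close>.\<close>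
      have "F \<subseteq> \<tau> n" for n
        using far dec by blast
      moreover have "\<tau> i \<subseteq> \<tau> j \<longleftrightarrow> j \<le> i" for i j
        using dec[of i j] dec[of j i] by (cases i j rule: linorder_cases) auto
      ultimately have "(u, v) \<in> Z1_order \<longleftrightarrow> e u \<subseteq> e v" for u v
        using table FG by (cases u rule: zpoint_cases; cases v rule: zpoint_cases)
          (auto simp: Z1_order_def)
      then show ?thesis by blast
    next
      case anti
      then have R: "\<tau> i \<subseteq> \<tau> j \<longleftrightarrow> i = j" for i j
        by blast
      show ?thesis
      proof (cases "\<forall>n. F \<subseteq> \<tau> n")
        case True
        then have "(u, v) \<in> Z2_order \<longleftrightarrow> e u \<subseteq> e v" for u v
          using table FG R by (cases u rule: zpoint_cases; cases v rule: zpoint_cases)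
            (auto simp: Z2_order_def)
        then show ?thesis by blast
      next
        case False
        then have "\<not> F \<subseteq> \<tau> n" for n
          using above by (auto simp: \<tau>_def)
        then have "(u, v) \<in> Z3_order \<longleftrightarrow> e u \<subseteq> e v" for u v
          using table FG R by (cases u rule: zpoint_cases; cases v rule: zpoint_cases)
            (auto simp: Z3_order_def)
        then show ?thesis by blast
      qed
    qed
  qed
  then obtain s where s: "s \<in> {Z1_order, Z2_order, Z3_order}"
    and emb: "\<And>u v. (u, v) \<in> s \<longleftrightarrow> e u \<subseteq> e v"
    by blast
  have "antisym s"
    using s by (auto simp: antisym_def Z1_order_def Z2_order_def Z3_order_def)
  \<comment> \<open>An order embedding is injective because \<open>s\<close> is
    antisymmetric.\<close>
  then have "inj e"
    using emb by (intro injI) (metis antisymD order_refl)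
  moreover have "Hausdorff_space (priestley_topology :: 'a set topology)"
    using metr by (rule metrizable_imp_Hausdorff_space)
  ultimately have "embedding_map Z_topology priestley_topology e"
    using pf lim\<tau> by (intro embedding_map_Z_topology) simp_all
  moreover have "e -` downset priestley_order (stone_map a) = {x_pt, y_pt}"
  proof (rule set_eqI)
    fix p
    have "p \<in> e -` downset priestley_order (stone_map a) \<longleftrightarrow> (\<exists>H\<in>stone_map a. e p \<subseteq> H)"
      using pf by (auto simp: downset_def priestley_order_iff stone_map_def)
    also have "\<dots> \<longleftrightarrow> p \<in> {x_pt, y_pt}"
      using FG G \<tau>(2) by (auto simp: e_def split: option.split isolated_point.split)
    finally show "p \<in> e -` downset priestley_order (stone_map a) \<longleftrightarrow> p \<in> {x_pt, y_pt}" .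
  qed
  ultimately show thesis
    using that[OF s, of e] emb pf G by (simp add: priestley_order_iff)
qed

section \<open>Homomorphisms onto the lattices \<open>L\<^sub>i\<close>\<close>

lemma is_upset_iff:
  assumes "Id \<subseteq> s"
  shows "is_upset s V \<longleftrightarrow> (\<forall>p q. p \<in> V \<longrightarrow> (p, q) \<in> s \<longrightarrow> q \<in> V)"
  using assms unfolding is_upset_def upset_def by blast

definition clopen_upsets :: "zpoint rel \<Rightarrow> zpoint set set" where
  "clopen_upsets s = {V. clopenin Z_topology V \<and> is_upset s V}"

lemma Z_embedding_annihilator_image:
  fixes a :: "'a::{distrib_lattice,bounded_lattice}" and e :: "zpoint \<Rightarrow> 'a set"
  assumes e: "continuous_map Z_topology priestley_topology e"
    and ord: "\<forall>u v. (u, v) \<in> s \<longleftrightarrow> (e u, e v) \<in> priestley_order"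
    and xy: "(x_pt, y_pt) \<in> s"
    and pre: "e -` downset priestley_order (stone_map a) = {x_pt, y_pt}"
  shows "range (\<lambda>b. {p. b \<in> e p}) = clopen_upsets s"
    and "(\<lambda>b. {p. b \<in> e p}) ` rel_annihilator UNIV a bot = {V \<in> clopen_upsets s. y_pt \<notin> V}"
proof -
  let ?h = "\<lambda>b. {p. b \<in> e p}"
  have pf: "prime_filter (e p)" for p
    using continuous_map_image_subset_topspace[OF e] by auto
  have s: "(u, v) \<in> s \<longleftrightarrow> e u \<subseteq> e v" for u v
    using pf by (simp add: ord priestley_order_iff)
  have "Id \<subseteq> s"
    by (auto simp: s)
  note up = is_upset_iff[OF this]
  have D: "(\<exists>G\<in>stone_map a. e p \<subseteq> G) \<longleftrightarrow> p \<in> {x_pt, y_pt}" for p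
    unfolding pre [symmetric] using pf
    by (auto simp: downset_def priestley_order_iff stone_map_def)
  have h: "?h b \<in> clopen_upsets s" for b
  proof -
    have "?h b = {p \<in> topspace Z_topology. e p \<in> stone_map b}"
      using pf by (simp add: stone_map_def)
    then have "clopenin Z_topology (?h b)"
      using openin_continuous_map_preimage[OF e openin_stone_map[of b]]
        closedin_continuous_map_preimage[OF e closedin_stone_map[of b]]
      unfolding clopenin_def by simp
    then show ?thesis
      by (auto simp: clopen_upsets_def up s)
  qed
  \<comment> \<open>The point \<open>e y_pt\<close> lies below some \<open>G\<close> containing
    \<open>a\<close>, so \<open>d \<in> e y_pt\<close> would give \<open>d \<in> G\<close>.\<close>
  have not_y: "y_pt \<notin> ?h d" if "inf d a = bot" for d
  proof
    assume "y_pt \<in> ?h d"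
    moreover obtain G where "G \<in> stone_map a" "e y_pt \<subseteq> G"
      using D[of y_pt] by blast
    ultimately show False
      using that[unfolded inf_eq_bot_iff_stone_map] by blast
  qed
  have lift: "\<exists>d. ?h d = V \<and> (y_pt \<notin> V \<longrightarrow> inf d a = bot)" if V: "V \<in> clopen_upsets s" for V
  proof -
    have cl: "closedin Z_topology V" "closedin Z_topology (- V)"
      using V by (auto simp: clopen_upsets_def clopenin_def closedin_def Compl_eq_Diff_UNIV double_diff)
    then have "compactin priestley_topology (e ` V)" "compactin priestley_topology (e ` (- V))"
      using e closedin_compact_space[OF compact_space_Z_topology] image_compactin by blast+
    \<comment> \<open>Adding \<open>stone_map a\<close> to the set to be avoided makes the
      separating element disjoint from \<open>a\<close>; this can only be asked when
      \<open>V\<close> misses \<open>y_pt\<close>.\<close>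
    moreover define K' where "K' = e ` (- V) \<union> (if y_pt \<in> V then {} else stone_map a)"
    ultimately have comp: "compactin priestley_topology (e ` V)" "compactin priestley_topology K'"
      by (auto intro: compactin_Un compactin_stone_map)
    have upV: "q \<in> V" if "p \<in> V" "e p \<subseteq> e q" for p q
      using V that unfolding clopen_upsets_def by (auto simp: up s)
    have "e x_pt \<subseteq> e y_pt"
      using xy by (simp add: s)
    have "\<not> F \<subseteq> G" if F: "F \<in> e ` V" and G: "G \<in> K'" for F G
    proof
      assume "F \<subseteq> G"
      obtain p where p: "p \<in> V" "F = e p" using F by blast
      consider q where "q \<notin> V" "G = e q" | "y_pt \<notin> V" "G \<in> stone_map a"
        using G by (auto simp: K'_def split: if_splits)
      then show False
      proof cases
        case 1
        then show ?thesis using upV p \<open>F \<subseteq> G\<close> by blast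
      next
        case 2
        \<comment> \<open>By \<open>pre\<close>, only these two points are mapped below
          \<open>stone_map a\<close>; since \<open>V\<close> is an upset and \<open>x_pt\<close> is
          below \<open>y_pt\<close>, either one forces \<open>y_pt \<in> V\<close>.\<close>
        then have "p \<in> {x_pt, y_pt}"
          using D[of p] p \<open>F \<subseteq> G\<close> by blast
        then show ?thesis using 2(1) p(1) upV[of x_pt y_pt] \<open>e x_pt \<subseteq> e y_pt\<close> by auto
      qed
    qed
    then obtain d where d: "e ` V \<subseteq> stone_map d" "stone_map d \<inter> K' = {}"
      by (rule compactin_stone_map_separation[OF comp])
    have "?h d = V"
      using d pf by (auto simp: K'_def stone_map_def)
    moreover have "inf d a = bot" if "y_pt \<notin> V"
      using d(2) that by (intro inf_eq_bot_iff_stone_map[THEN iffD2]) (auto simp: K'_def stone_map_def)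
    ultimately show ?thesis by blast
  qed
  show "range ?h = clopen_upsets s"
    using h lift by blast
  show "?h ` rel_annihilator UNIV a bot = {V \<in> clopen_upsets s. y_pt \<notin> V}"
  proof (intro equalityI subsetI)
    fix V assume "V \<in> ?h ` rel_annihilator UNIV a bot"
    then show "V \<in> {V \<in> clopen_upsets s. y_pt \<notin> V}"
      using h not_y by (auto simp: rel_annihilator_def bot_unique)
  next
    fix V assume "V \<in> {V \<in> clopen_upsets s. y_pt \<notin> V}"
    then obtain d where "?h d = V" "inf d a = bot"
      using lift by blast
    then show "V \<in> ?h ` rel_annihilator UNIV a bot"
      by (auto simp: rel_annihilator_def)
  qed
qed

text \<open>Here \<open>\<phi>\<close> transports the clopen upsets to a concrete lattice
  \<open>M\<close>, and the last hypothesis says that annihilating \<open>c\<close> corresponds to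
  missing \<open>y_pt\<close>.\<close>

lemma Z_embedding_onto_hom:
  fixes a :: "'a::{distrib_lattice,bounded_lattice}" and \<phi> :: "zpoint set \<Rightarrow> 'b::bounded_lattice"
  assumes e: "embedding_map Z_topology priestley_topology e"
    and ord: "\<forall>u v. (u, v) \<in> s \<longleftrightarrow> (e u, e v) \<in> priestley_order"
    and xy: "(x_pt, y_pt) \<in> s"
    and pre: "e -` downset priestley_order (stone_map a) = {x_pt, y_pt}"
    and \<phi>: "\<phi> {} = bot" "\<phi> UNIV = top"
      "\<And>V W. V \<in> clopen_upsets s \<Longrightarrow> W \<in> clopen_upsets s \<Longrightarrow> \<phi> (V \<inter> W) = inf (\<phi> V) (\<phi> W)"
      "\<And>V W. V \<in> clopen_upsets s \<Longrightarrow> W \<in> clopen_upsets s \<Longrightarrow> \<phi> (V \<union> W) = sup (\<phi> V) (\<phi> W)"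
      "\<phi> ` clopen_upsets s = M"
    and c: "\<And>V. V \<in> clopen_upsets s \<Longrightarrow> inf (\<phi> V) c = bot \<longleftrightarrow> y_pt \<notin> V"
  shows "\<exists>h. onto_bounded_lattice_hom h M \<and>
    (\<exists>a::'a. h ` rel_annihilator UNIV a bot = rel_annihilator M c bot)"
proof -
  let ?h = "\<lambda>b. {p. b \<in> e p}"
  have cont: "continuous_map Z_topology priestley_topology e"
    using e by (rule embedding_map_imp_continuous_map)
  have pf: "prime_filter (e p)" for p
    using continuous_map_image_subset_topspace[OF cont] by auto
  note im = Z_embedding_annihilator_image[OF cont ord xy pre]
  have cu: "?h b \<in> clopen_upsets s" for b
    using im(1) by blast
  have hom: "?h bot = {}" "?h top = UNIV" "?h (inf b d) = ?h b \<inter> ?h d" "?h (sup b d) = ?h b \<union> ?h d" for b d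
    using pf by (auto simp: prime_filterD)
  have "range (\<lambda>b. \<phi> (?h b)) = M"
    unfolding \<phi>(5) [symmetric] im(1) [symmetric] by (simp add: image_image)
  then have "onto_bounded_lattice_hom (\<lambda>b. \<phi> (?h b)) M"
    unfolding onto_bounded_lattice_hom_def hom using \<phi>(1-4) cu by simp
  moreover have "(\<lambda>b. \<phi> (?h b)) ` rel_annihilator UNIV a bot = \<phi> ` (?h ` rel_annihilator UNIV a bot)"
    by (simp add: image_image)
  moreover have "\<dots> = rel_annihilator M c bot"
    using c unfolding im(2) by (auto simp: rel_annihilator_def bot_unique simp flip: \<phi>(5))
  ultimately show ?thesis by metis
qed

section \<open>The clopen upsets matched with the three concrete lattices\<close>

lemma clopen_upsets_Z1: "clopen_upsets Z1_order = L1"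
  by (simp add: clopen_upsets_def L1_def)

text \<open>The point \<open>x_pt\<close> is least, so an upset containing it is everything; all
  other points are maximal, so any set of them is an upset.\<close>

lemma clopen_upsets_Z2: "V \<in> clopen_upsets Z2_order \<longleftrightarrow> V = UNIV \<or> x_pt \<notin> V \<and> finite V"
proof -
  have "Id \<subseteq> Z2_order" by (auto simp: Z2_order_def)
  note up = is_upset_iff[OF this]
  show ?thesis
  proof (cases "x_pt \<in> V")
    case True
    have "V = UNIV" if "is_upset Z2_order V"
    proof -
      have "(x_pt, p) \<in> Z2_order" for p
        by (cases p rule: zpoint_cases) (auto simp: Z2_order_def)
      then have "p \<in> V" for p
        using that True unfolding up by blast
      then show ?thesis by blast
    qed
    moreover have "UNIV \<in> clopen_upsets Z2_order"
      by (simp add: clopen_upsets_def up clopenin_Z_topology_iff)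
    ultimately show ?thesis using True by (auto simp: clopen_upsets_def)
  next
    case False
    then have "q = p" if "p \<in> V" "(p, q) \<in> Z2_order" for p q
      using that by (auto simp: Z2_order_def)
    then have "is_upset Z2_order V"
      unfolding up by blast
    then show ?thesis
      using False by (auto simp: clopen_upsets_def clopenin_Z_topology_iff)
  qed
qed

lemma clopen_upsets_Z3:
  "V \<in> clopen_upsets Z3_order \<longleftrightarrow> (if x_pt \<in> V then y_pt \<in> V \<and> finite (- V) else finite V)"
proof -
  have "Id \<subseteq> Z3_order" by (auto simp: Z3_order_def)
  then show ?thesis
    by (auto simp: clopen_upsets_def is_upset_iff clopenin_Z_topology_iff Z3_order_def)
qed

text \<open>The points are renumbered so that \<open>y_pt\<close> becomes \<open>0\<close> and
  \<open>z_pt m\<close> becomes \<open>Suc m\<close>; thus \<open>{y_pt}\<close> goes to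
  \<open>c2\<close>. Sets containing \<open>x_pt\<close> go to the added top, the only such clopen
  upset of \<open>Z2_order\<close> being the whole space.\<close>

definition L2_map :: "zpoint set \<Rightarrow> nat set top" where
  "L2_map V = (if x_pt \<in> V then top.Top else top.Value {n. (case n of 0 \<Rightarrow> y_pt | Suc m \<Rightarrow> z_pt m) \<in> V})"

text \<open>Nothing is lost by omitting \<open>x_pt\<close>: a clopen set contains it exactly when
  it contains infinitely many \<open>z_pt n\<close>.\<close>

definition L3_map :: "zpoint set \<Rightarrow> nat set \<times> bool" where
  "L3_map V = ({n. z_pt n \<in> V}, y_pt \<in> V)"

lemma L2_map_image: "L2_map ` clopen_upsets Z2_order = L2"
proof -
  define \<iota> where "\<iota> n = (case n of 0 \<Rightarrow> y_pt | Suc m \<Rightarrow> z_pt m)" for n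
  have inj: "inj \<iota>" and x: "x_pt \<notin> range \<iota>"
    by (auto simp: inj_def \<iota>_def split: nat.splits)
  have map: "L2_map V = (if x_pt \<in> V then top.Top else top.Value (\<iota> -` V))" for V
    by (simp add: L2_map_def \<iota>_def vimage_def)
  show ?thesis
  proof (intro equalityI subsetI)
    fix m assume "m \<in> L2_map ` clopen_upsets Z2_order"
    then show "m \<in> L2"
      using finite_vimageI[OF _ inj] by (auto simp: clopen_upsets_Z2 map L2_def)
  next
    fix m assume "m \<in> L2"
    then consider "m = top.Top" | A where "m = top.Value A" "finite A"
      by (auto simp: L2_def)
    then show "m \<in> L2_map ` clopen_upsets Z2_order"
    proof cases
      case 1
      then show ?thesis by (intro image_eqI[of _ _ UNIV]) (auto simp: map clopen_upsets_Z2)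
    next
      case 2
      then show ?thesis using x
        by (intro image_eqI[of _ _ "\<iota> ` A"]) (auto simp: map clopen_upsets_Z2 inj_vimage_image_eq[OF inj])
    qed
  qed
qed

lemma L3_map_image: "L3_map ` clopen_upsets Z3_order = L3"
proof (intro equalityI subsetI)
  have inj: "inj z_pt" by (simp add: inj_def)
  fix m assume "m \<in> L3_map ` clopen_upsets Z3_order"
  then obtain V where V: "m = L3_map V" "V \<in> clopen_upsets Z3_order" by blast
  have "finite (z_pt -` V)" if "finite V" using that inj by (rule finite_vimageI)
  moreover have "finite (- (z_pt -` V))" if "finite (- V)"
    using finite_vimageI[OF that inj] by (simp add: vimage_Compl)
  ultimately show "m \<in> L3"
    using V by (auto simp: clopen_upsets_Z3 L3_map_def L3_def CF_def vimage_def split: if_splits)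
next
  fix m assume "m \<in> L3"
  then obtain A n where m: "m = (A, n)" "A \<in> CF" "finite A \<or> n"
    by (auto simp: L3_def)
  \<comment> \<open>The limit point \<open>x_pt\<close> is included exactly when \<open>A\<close> is
    infinite; \<open>n\<close> then holds, so \<open>y_pt\<close> is present as the order
    requires.\<close>
  define V where "V = (if finite A then {} else {x_pt}) \<union> (if n then {y_pt} else {}) \<union> z_pt ` A"
  have "L3_map V = m"
    using m by (auto simp: L3_map_def V_def)
  moreover have "V \<in> clopen_upsets Z3_order"
  proof (cases "finite A")
    case True
    then show ?thesis by (auto simp: clopen_upsets_Z3 V_def)
  next
    case False
    have "- V \<subseteq> z_pt ` (- A)"
    proof
      fix p assume "p \<in> - V"
      then show "p \<in> z_pt ` (- A)"
        using False m(3) by (cases p rule: zpoint_cases) (auto simp: V_def)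
    qed
    moreover have "finite (- A)"
      using False m(2) by (simp add: CF_def)
    ultimately have "finite (- V)"
      by (meson finite_imageI finite_subset)
    moreover have "x_pt \<in> V" "y_pt \<in> V"
      using False m(3) by (auto simp: V_def)
    ultimately show ?thesis by (simp add: clopen_upsets_Z3)
  qed
  ultimately show "m \<in> L3_map ` clopen_upsets Z3_order" by blast
qed

section \<open>Annihilators without a greatest element\<close>

lemma rel_annihilator_L1_no_greatest:
  "\<not> (\<exists>m\<in>rel_annihilator L1 c1 bot. \<forall>n\<in>rel_annihilator L1 c1 bot. n \<le> m)"
proof
  assume "\<exists>m\<in>rel_annihilator L1 c1 bot. \<forall>n\<in>rel_annihilator L1 c1 bot. n \<le> m"
  then obtain m where m: "m \<in> L1" "y_pt \<notin> m" and max: "\<And>n. n \<in> rel_annihilator L1 c1 bot \<Longrightarrow> n \<subseteq> m"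
    by (auto simp: rel_annihilator_def c1_def)
  have "z_pt ` {..n} \<in> rel_annihilator L1 c1 bot" for n
    by (auto simp: rel_annihilator_def L1_eq c1_def)
  from max[OF this] have "range z_pt \<subseteq> m" by fastforce
  \<comment> \<open>An upset containing \<open>x_pt\<close> would contain \<open>y_pt\<close>; and a
    clopen set without \<open>x_pt\<close> is finite, so it cannot contain all
    \<open>z_pt n\<close>.\<close>
  moreover have "x_pt \<notin> m"
    using m by (auto simp: L1_def is_upset_def upset_def Z1_order_def)
  then have "finite m"
    using m(1) by (auto simp: L1_def clopenin_Z_topology_iff)
  ultimately have "finite (range z_pt)"
    by (rule finite_subset)
  then show False
    by (simp add: finite_image_iff inj_on_def)
qed

lemma rel_annihilator_L2_no_greatest:
  "\<not> (\<exists>m\<in>rel_annihilator L2 c2 bot. \<forall>n\<in>rel_annihilator L2 c2 bot. n \<le> m)"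
proof
  assume "\<exists>m\<in>rel_annihilator L2 c2 bot. \<forall>n\<in>rel_annihilator L2 c2 bot. n \<le> m"
  then obtain m where m: "m \<in> rel_annihilator L2 c2 bot"
    and max: "\<And>n. n \<in> rel_annihilator L2 c2 bot \<Longrightarrow> n \<le> m"
    by blast
  \<comment> \<open>The added top is excluded because its meet with \<open>c2\<close> is
    \<open>c2\<close>, which is not the bottom.\<close>
  obtain A where A: "m = top.Value A" "finite A"
    using m by (auto simp: rel_annihilator_def L2_def c2_def inf_top_def bot_top_def less_eq_top_def)
  have "top.Value {Suc n} \<in> rel_annihilator L2 c2 bot" for n
    by (auto simp: rel_annihilator_def L2_def c2_def inf_top_def bot_top_def)
  from max[OF this] have "range Suc \<subseteq> A"
    by (auto simp: A less_eq_top_def)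
  then have "finite (range Suc)"
    using A(2) by (rule finite_subset)
  then show False
    by (simp add: finite_image_iff)
qed

lemma rel_annihilator_L3_no_greatest:
  "\<not> (\<exists>m\<in>rel_annihilator L3 c3 bot. \<forall>n\<in>rel_annihilator L3 c3 bot. n \<le> m)"
proof
  assume "\<exists>m\<in>rel_annihilator L3 c3 bot. \<forall>n\<in>rel_annihilator L3 c3 bot. n \<le> m"
  then obtain m where m: "m \<in> rel_annihilator L3 c3 bot"
    and max: "\<And>n. n \<in> rel_annihilator L3 c3 bot \<Longrightarrow> n \<le> m"
    by blast
  \<comment> \<open>Annihilating \<open>c3\<close> forces the second coordinate to be
    \<open>False\<close>, and then membership in \<open>L3\<close> forces \<open>A\<close> to be
    finite.\<close>
  obtain A where A: "m = (A, False)" "finite A"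
    using m by (auto simp: rel_annihilator_def L3_def c3_def bot_prod_def)
  have "({n}, False) \<in> rel_annihilator L3 c3 bot" for n
    by (auto simp: rel_annihilator_def L3_def CF_def c3_def bot_prod_def)
  from max[OF this] have "UNIV \<subseteq> A"
    by (auto simp: A)
  then show False
    using A(2) by (simp add: top.extremum_unique)
qed

theorem corollary3p5:
  assumes countable_L: "countable (UNIV :: 'a::{distrib_lattice,bounded_lattice} set)"
  shows "metrizable_space (priestley_topology :: 'a set topology) \<and>
        (\<not> p_space (priestley_topology :: 'a set topology) priestley_order \<longleftrightarrow>
         (\<exists>s\<in>{Z1_order, Z2_order, Z3_order}.
            p_configuration s (priestley_topology :: 'a set topology) priestley_order)) \<and>
        (\<not> p_algebra TYPE('a) \<longleftrightarrow>
         (\<exists>h. onto_bounded_lattice_hom h L1 \<and>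
            (\<exists>a::'a. h ` rel_annihilator UNIV a bot = rel_annihilator L1 c1 bot)) \<or>
         (\<exists>h. onto_bounded_lattice_hom h L2 \<and>
            (\<exists>a::'a. h ` rel_annihilator UNIV a bot = rel_annihilator L2 c2 bot)) \<or>
         (\<exists>h. onto_bounded_lattice_hom h L3 \<and>
            (\<exists>a::'a. h ` rel_annihilator UNIV a bot = rel_annihilator L3 c3 bot)))"
    (is "_ \<and> (_ \<longleftrightarrow> ?config) \<and> (_ \<longleftrightarrow> ?hom1 \<or> ?hom2 \<or> ?hom3)")
proof (intro conjI iffI)
  show metr: "metrizable_space (priestley_topology :: 'a set topology)"
    using countable_L by (rule metrizable_priestley_topology)
  show ?config if not_p: "\<not> p_space (priestley_topology :: 'a set topology) priestley_order"
  proof -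
    obtain a :: 'a where "\<not> openin priestley_topology (downset priestley_order (stone_map a))"
      using not_p p_space_if_open_downsets by blast
    then obtain s e where s: "s \<in> {Z1_order, Z2_order, Z3_order}"
      and e: "embedding_map Z_topology priestley_topology e"
        "\<forall>u v. (u, v) \<in> s \<longleftrightarrow> (e u, e v) \<in> priestley_order"
        "e y_pt \<in> stone_map a"
        "e -` downset priestley_order (stone_map a) = {x_pt, y_pt}"
      by (rule not_open_downset_Z_embedding[OF metr])
    have "p_configuration s (priestley_topology :: 'a set topology) priestley_order"
      unfolding p_configuration_def
      by (intro exI[of _ e] exI[of _ "stone_map a"] conjI e openin_stone_map is_upset_stone_map)
    then show ?thesis using s by (rule bexI)
  qed
  show "\<not> p_space (priestley_topology :: 'a set topology) priestley_order" if ?config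
    using that p_space_no_p_configuration by blast
  show "?hom1 \<or> ?hom2 \<or> ?hom3" if not_p: "\<not> p_algebra TYPE('a)"
  proof -
    obtain a :: 'a where "\<not> openin priestley_topology (downset priestley_order (stone_map a))"
      using not_p p_algebra_if_open_downsets by blast
    then obtain s e where s: "s \<in> {Z1_order, Z2_order, Z3_order}"
      and e: "embedding_map Z_topology priestley_topology e"
        "\<forall>u v. (u, v) \<in> s \<longleftrightarrow> (e u, e v) \<in> priestley_order"
        "e -` downset priestley_order (stone_map a) = {x_pt, y_pt}"
      by (rule not_open_downset_Z_embedding[OF metr])
    have xy: "(x_pt, y_pt) \<in> s"
      using s by (auto simp: Z1_order_def Z2_order_def Z3_order_def)
    note hom = Z_embedding_onto_hom[OF e(1,2) xy e(3)]
    consider "s = Z1_order" | "s = Z2_order" | "s = Z3_order"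
      using s by blast
    then show ?thesis
    proof cases
      case 1
      \<comment> \<open>The identity serves as \<open>\<phi>\<close>, since \<open>L1\<close> is
        itself the lattice of clopen upsets and a set meets \<open>{y_pt}\<close> exactly when it
        contains \<open>y_pt\<close>.\<close>
      have ?hom1
        by (rule hom[of "\<lambda>V. V"]) (simp_all add: 1 clopen_upsets_Z1 c1_def)
      then show ?thesis by blast
    next
      case 2
      have ?hom2
      proof (rule hom[of L2_map])
        show "L2_map ` clopen_upsets s = L2"
          by (simp add: 2 L2_map_image)
        show "L2_map {} = bot" "L2_map UNIV = top"
          by (simp_all add: L2_map_def bot_top_def top_top_def)
        fix V W assume V: "V \<in> clopen_upsets s" and W: "W \<in> clopen_upsets s"
        show "L2_map (V \<inter> W) = inf (L2_map V) (L2_map W)" "L2_map (V \<union> W) = sup (L2_map V) (L2_map W)"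
          using V W by (auto simp: 2 clopen_upsets_Z2 L2_map_def inf_top_def sup_top_def)
      next
        fix V assume "V \<in> clopen_upsets s"
        then show "inf (L2_map V) c2 = bot \<longleftrightarrow> y_pt \<notin> V"
          by (auto simp: 2 clopen_upsets_Z2 L2_map_def c2_def inf_top_def bot_top_def)
      qed
      then show ?thesis by blast
    next
      case 3
      have ?hom3
      proof (rule hom[of L3_map])
        show "L3_map ` clopen_upsets s = L3"
          by (simp add: 3 L3_map_image)
        show "L3_map {} = bot" "L3_map UNIV = top"
          by (simp_all add: L3_map_def bot_prod_def top_prod_def)
        fix V W
        show "L3_map (V \<inter> W) = inf (L3_map V) (L3_map W)" "L3_map (V \<union> W) = sup (L3_map V) (L3_map W)"
          by (auto simp: L3_map_def)
      next
        fix V show "inf (L3_map V) c3 = bot \<longleftrightarrow> y_pt \<notin> V"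
          by (simp add: L3_map_def c3_def bot_prod_def)
      qed
      then show ?thesis by blast
    qed
  qed
  show "\<not> p_algebra TYPE('a)" if "?hom1 \<or> ?hom2 \<or> ?hom3"
  proof
    assume p: "p_algebra TYPE('a)"
    \<comment> \<open>In each case the image of a pseudocomplement under \<open>h\<close> would be
      greatest in an annihilator that has no greatest element.\<close>
    from that show False
    proof (elim disjE exE conjE)
      fix h and a :: 'a
      assume "onto_bounded_lattice_hom h L1" "h ` rel_annihilator UNIV a bot = rel_annihilator L1 c1 bot"
      then show False
        using rel_annihilator_L1_no_greatest by (metis p_algebra_annihilator_has_greatest[OF p])
    next
      fix h and a :: 'a
      assume "onto_bounded_lattice_hom h L2" "h ` rel_annihilator UNIV a bot = rel_annihilator L2 c2 bot"
      then show False
        using rel_annihilator_L2_no_greatest by (metis p_algebra_annihilator_has_greatest[OF p])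
    next
      fix h and a :: 'a
      assume "onto_bounded_lattice_hom h L3" "h ` rel_annihilator UNIV a bot = rel_annihilator L3 c3 bot"
      then show False
        using rel_annihilator_L3_no_greatest by (metis p_algebra_annihilator_has_greatest[OF p])
    qed
  qed
qed

end
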